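(* Let $k\geq 3$ be an odd integer and let $p$ be a prime with $p\equiv 1 \pmod{4k}$. Then there are no integers $x,y,z$ (positive, negative or zero) satisfying $x^2+y^2+z^k=p^{k}$ and $z\equiv 2k \pmod{4k}$. *)

theory Defs
  imports "HOL-Number_Theory.Number_Theory"
begin

end

theory Submission
  imports Defs
begin

text \<open>
  Since \<open>z \<equiv> 2 (mod 4)\<close>, the factor \<open>p - z\<close> of \<open>p\<^sup>k - z\<^sup>k = x\<^sup>2 + y\<^sup>2\<close> is positive and
  congruent to \<open>3\<close> modulo \<open>4\<close>. A prime \<open>q \<equiv> 3 (mod 4)\<close> divides a sum of two squares to an even
  power but some such \<open>q\<close> divides \<open>p - z\<close> to an odd power, so it also divides
  the cofactor, which is congruent to \<open>k p\<^bsup>k-1\<^esup>\<close> modulo \<open>q\<close>. Hence \<open>q\<close> divides \<open>p\<close> or \<open>k\<close>; as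
  \<open>k\<close> divides \<open>z\<close>, either way \<open>q\<close> divides \<open>p\<close>, so \<open>q = p\<close>, contradicting \<open>p \<equiv> 1 (mod 4)\<close>.
\<close>

text \<open>Passing to the nonnegative residue of \<open>x\<close> reduces this to Fermat's little
  theorem on naturals; later the bases may be negative.\<close>

lemma fermat_theorem_int:
  fixes q :: nat and x :: int
  assumes "prime q" "\<not> int q dvd x"
  shows "[x ^ (q - 1) = 1] (mod int q)"
proof -
  have pos: "int q > 0"
    using assms(1) prime_gt_0_nat by simp
  define a where "a = nat (x mod int q)"
  have a: "int a = x mod int q"
    using pos by (simp add: a_def)
  have cong: "[x = int a] (mod int q)"
    by (simp add: a cong_def)
  have "\<not> q dvd a"
    using assms(2) cong cong_dvd_iff cong_sym int_dvd_int_iff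
    by (metis a dvd_mod_iff dvd_refl)
  then have "[a ^ (q - 1) = 1] (mod q)"
    using fermat_theorem assms(1) by blast
  then have "[int a ^ (q - 1) = 1] (mod int q)"
    by (metis cong_int_iff of_nat_1 of_nat_power)
  then show ?thesis
    using cong cong_pow cong_trans by blast
qed

text \<open>Otherwise \<open>q\<close> divides neither \<open>x\<close> nor \<open>y\<close>. Since
  \<open>(q - 1) div 2\<close> is odd, raising \<open>x\<^sup>2 = - y\<^sup>2\<close> to that power
  keeps the sign, and Fermat turns the result into \<open>1 = - 1\<close> modulo
  \<open>q\<close>.\<close>

lemma prime_3_mod_4_dvd_sum_squares:
  fixes q :: nat and x y :: int
  assumes "prime q" "q mod 4 = 3" "int q dvd x\<^sup>2 + y\<^sup>2"
  shows "int q dvd x"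
proof (rule ccontr)
  assume x: "\<not> int q dvd x"
  have prime: "prime (int q)"
    using assms(1) by simp
  have y: "\<not> int q dvd y"
  proof
    assume "int q dvd y"
    then have "int q dvd x\<^sup>2"
      using assms(3) by (simp add: dvd_add_left_iff power2_eq_square)
    then show False
      using x prime prime_dvd_power by blast
  qed
  define m where "m = (q - 1) div 2"
  have m: "q - 1 = 2 * m" "odd m"
    using assms(2) unfolding m_def by presburger+
  have "[x\<^sup>2 = - (y\<^sup>2)] (mod int q)"
    using assms(3) by (simp add: cong_iff_dvd_diff)
  then have "[(x\<^sup>2) ^ m = (- (y\<^sup>2)) ^ m] (mod int q)"
    by (rule cong_pow)
  then have eq: "[x ^ (q - 1) = - (y ^ (q - 1))] (mod int q)"
    using m by (simp add: power_mult)
  have "[- (y ^ (q - 1)) = - 1] (mod int q)"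
    using fermat_theorem_int[OF assms(1) y] by (simp add: cong_minus_minus_iff)
  then have "[1 = - 1] (mod int q)"
    using fermat_theorem_int[OF assms(1) x] eq cong_sym cong_trans by blast
  then have "int q dvd 2"
    by (simp add: cong_iff_dvd_diff)
  then have "int q \<le> 2"
    using zdvd_imp_le by fastforce
  with assms(2) show False
    by (cases "q = 0 \<or> q = 1 \<or> q = 2") auto
qed

text \<open>Dividing out a prime factor that is 1 modulo 4 leaves the residue 3 unchanged, so the
  induction descends to the cofactor.\<close>

lemma exists_prime_3_mod_4_factor:
  fixes a :: nat
  assumes "a mod 4 = 3"
  shows "\<exists>q. prime q \<and> q mod 4 = 3 \<and> q dvd a"
  using assms
proof (induction a rule: less_induct)
  case (less a)
  then have "a \<noteq> 1" by auto
  then obtain q where q: "prime q" "q dvd a"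
    using prime_factor_nat by blast
  then obtain b where b: "a = q * b"
    by (elim dvdE)
  have "odd a"
    using less.prems by presburger
  then have "odd q"
    using b by simp
  show ?case
  proof (cases "q mod 4 = 3")
    case True
    with q show ?thesis by blast
  next
    case False
    with \<open>odd q\<close> have "q mod 4 = 1"
      by presburger
    then have "b mod 4 = 3"
      using less.prems unfolding b by (metis mod_mult_left_eq mult_1)
    moreover have "b < a"
      using b less.prems prime_gt_1_nat[OF q(1)] by (cases "b = 0") auto
    ultimately show ?thesis
      using less.IH b by (metis dvd_mult)
  qed
qed

text \<open>Descent in place of counting exponents: if \<open>q\<close> does not divide
  \<open>b\<close>, then \<open>q\<^sup>2\<close> divides \<open>a\<close>. As
  \<open>q\<^sup>2\<close> is 1 modulo 4, dividing \<open>a\<close> by it keeps the residue 3, and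
  \<open>b\<close> stays the same while \<open>x\<close> and \<open>y\<close> are divided by
  \<open>q\<close>.\<close>

lemma sum_squares_factor_3_mod_4:
  fixes a :: nat and b x y :: int
  assumes "a mod 4 = 3" "int a * b = x\<^sup>2 + y\<^sup>2"
  shows "\<exists>q. prime q \<and> q mod 4 = 3 \<and> q dvd a \<and> int q dvd b"
  using assms
proof (induction a arbitrary: x y rule: less_induct)
  case (less a)
  obtain q where q: "prime q" "q mod 4 = 3" "q dvd a"
    using exists_prime_3_mod_4_factor[OF less.prems(1)] by blast
  show ?case
  proof (cases "int q dvd b")
    case True
    with q show ?thesis by blast
  next
    case False
    have dvd: "int q dvd x\<^sup>2 + y\<^sup>2"
      using q(3) less.prems(2) by (metis dvd_mult2 int_dvd_int_iff)
    obtain u where u: "x = int q * u"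
      using prime_3_mod_4_dvd_sum_squares[OF q(1,2) dvd] by (elim dvdE)
    obtain v where v: "y = int q * v"
      using prime_3_mod_4_dvd_sum_squares[OF q(1,2), of y x] dvd
      by (metis add.commute dvdE)
    obtain c where c: "a = q * c"
      using q(3) by (elim dvdE)
    have q0: "q > 1"
      using q(1) prime_gt_1_nat by blast
    have "int q * (int c * b) = int q * (int q * (u\<^sup>2 + v\<^sup>2))"
      using less.prems(2) by (simp add: c u v power2_eq_square algebra_simps)
    then have cb: "int c * b = int q * (u\<^sup>2 + v\<^sup>2)"
      using q0 by simp
    then have "int q dvd int c"
      using False q(1) by (metis dvd_triv_left prime_dvd_mult_iff prime_nat_int_transfer)
    then obtain d where d: "c = q * d"
      by (metis dvdE int_dvd_int_iff)
    have db: "int d * b = u\<^sup>2 + v\<^sup>2"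
      using cb q0 by (simp add: d)
    have a: "a = q * q * d"
      by (simp add: c d)
    have "q * q mod 4 = 1"
      using q(2) mod_mult_eq[of q 4 q] by simp
    then have "d mod 4 = 3"
      using less.prems(1) unfolding a by (metis mod_mult_left_eq mult_1)
    moreover have "d < a"
    proof -
      have "d > 0"
        using less.prems(1) by (cases "d = 0") (auto simp: a)
      moreover have "1 < q * q"
        using q0 by (simp add: one_less_mult)
      ultimately show ?thesis
        unfolding a by simp
    qed
    ultimately obtain r where "prime r" "r mod 4 = 3" "r dvd d" "int r dvd b"
      using less.IH db by blast
    then show ?thesis
      unfolding a by (meson dvd_mult)
  qed
qed

theorem theorem1:
  fixes k p :: nat
  assumes "k \<ge> 3" and "odd k"
    and "prime p" and "[p = 1] (mod 4 * k)"
  shows "\<not> (\<exists>x y z :: int. x ^ 2 + y ^ 2 + z ^ k = int p ^ k \<and> [z = 2 * int k] (mod 4 * int k))"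
proof
  assume "\<exists>x y z :: int. x ^ 2 + y ^ 2 + z ^ k = int p ^ k \<and> [z = 2 * int k] (mod 4 * int k)"
  then obtain x y z :: int where
    eq: "x ^ 2 + y ^ 2 + z ^ k = int p ^ k" and z: "[z = 2 * int k] (mod 4 * int k)"
    by blast
  have "[p = 1] (mod 4)"
    using assms(4) cong_dvd_modulus_nat dvd_triv_left by blast
  then have p4: "p mod 4 = 1"
    by (simp add: cong_def)
  have "[z = 2 * int k] (mod 4)"
    using z cong_dvd_modulus dvd_triv_left by blast
  then have z4: "z mod 4 = 2"
    using assms(2) unfolding cong_def by presburger
  have kz: "int k dvd z"
    using z by (metis cong_dvd_iff cong_dvd_modulus dvd_triv_right)
  \<comment> \<open>This yields \<open>z \<le> int p\<close>, so that \<open>nat\<close> does not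
    truncate in the definition of \<open>a\<close>; a negative \<open>z\<close> does no
    harm.\<close>
  have "z ^ k \<le> int p ^ k"
    using eq zero_le_power2[of x] zero_le_power2[of y] by linarith
  then have "z \<le> int p"
    using assms(1) power_strict_mono[of "int p" z k] by fastforce
  define a where "a = nat (int p - z)"
  have a: "int a = int p - z"
    using \<open>z \<le> int p\<close> by (simp add: a_def)
  have a4: "a mod 4 = 3"
    using a p4 z4 by presburger
  \<comment> \<open>The cofactor of \<open>int p - z\<close> in
    \<open>int p ^ k - z ^ k\<close>.\<close>
  define b where "b = (\<Sum>i<k. z ^ (k - Suc i) * int p ^ i)"
  have "int a * b = x\<^sup>2 + y\<^sup>2"
    using eq power_diff_sumr2[of "int p" k z] by (simp add: a b_def)
  then obtain q where q: "prime q" "q mod 4 = 3" "q dvd a" "int q dvd b"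
    using sum_squares_factor_3_mod_4[OF a4] by blast
  have qa: "int q dvd int p - z"
    using q(3) a by (metis int_dvd_int_iff)
  then have "[z = int p] (mod int q)"
    by (metis cong_iff_dvd_diff cong_sym)
  \<comment> \<open>Replacing \<open>z\<close> by \<open>int p\<close> makes all \<open>k\<close>
    summands equal to \<open>int p ^ (k - 1)\<close>.\<close>
  then have "[b = (\<Sum>i<k. int p ^ (k - Suc i) * int p ^ i)] (mod int q)"
    unfolding b_def by (intro cong_sum cong_mult cong_pow cong_refl)
  also have "(\<Sum>i<k. int p ^ (k - Suc i) * int p ^ i) = (\<Sum>i<k. int p ^ (k - 1))"
    by (intro sum.cong) (auto simp flip: power_add)
  finally have "[b = int k * int p ^ (k - 1)] (mod int q)"
    by simp
  then have "int q dvd int k * int p ^ (k - 1)"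
    using q(4) cong_dvd_iff by blast
  then have "int q dvd int k \<or> int q dvd int p"
    using q(1) by (metis prime_dvd_mult_iff prime_dvd_power prime_nat_int_transfer)
  then have "int q dvd int p"
    using kz qa by (metis dvd_diff_left_iff dvd_trans)
  then have "q = p"
    using q(1) assms(3) by (simp add: primes_dvd_imp_eq)
  with q(2) p4 show False
    by simp
qed

end
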